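(* Let $\mathbb{F}=\mathbb{F}_q$, $n_1,n_2\in\mathbb{N}$, $n=n_1+n_2$, and let $\mathcal{M}_i=(\mathbb{F}^{n_i},\rho_i)$, $i=1,2$, be $q$-matroids of rank $k_i$. Let $\mathcal{M}=\mathcal{M}_1\oplus\mathcal{M}_2$ and suppose $\mathcal{M}$ is representable over $\mathbb{F}_{q^m}$. Then $\mathcal{M}_1$ and $\mathcal{M}_2$ are representable over $\mathbb{F}_{q^m}$, and $\mathcal{M}=\mathcal{M}_G$ for a matrix of the form \[ G=\begin{pmatrix}G_1&0\\0&G_2\end{pmatrix}, \] where $G_i\in\mathbb{F}_{q^m}^{k_i\times n_i}$ satisfy $\mathcal{M}_{G_i}=\mathcal{M}_i$ for $i=1,2$.
   Context: A $q$-matroid with ground space $E$ (a finite-dimensional $\mathbb{F}_q$-vector space) is a pair $(E,\rho)$ with $\rho$ a map from the set of subspaces of $E$ to $\mathbb{N}_{\ge0}$ satisfying $0\le\rho(V)\le\dim V$, monotonicity, and submodularity $\rho(V+W)+\rho(V\cap W)\le\rho(V)+\rho(W)$; its rank is $\rho(E)$. Two $q$-matroids on the same ground space are equal if their rank functions agree. Representability: for $G\in\mathbb{F}_{q^m}^{k\times n}$, $\mathcal{M}_G=(\mathbb{F}_q^n,\rho_G)$ where $\rho_G(V)=\operatorname{rk}_{\mathbb{F}_{q^m}}(GY^{\mathsf T})$ for any matrix $Y$ over $\mathbb{F}_q$ with $n$ columns whose row space is $V$ (this is well defined and is a $q$-matroid). A $q$-matroid on $\mathbb{F}_q^n$ is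 representable over $\mathbb{F}_{q^m}$ if it equals $\mathcal{M}_G$ for some matrix $G$ over $\mathbb{F}_{q^m}$ with $n$ columns (whose rank equals the rank of the $q$-matroid). Direct sum: write $\mathbb{F}^n=\mathbb{F}^{n_1}\oplus\mathbb{F}^{n_2}$ with $\pi_1,\pi_2$ the projections onto the first $n_1$ and last $n_2$ coordinates. Put $\rho_i'(V)=\rho_i(\pi_i(V))$ for $V\le\mathbb{F}^n$, $\mathcal{X}=\{X\le\mathbb{F}^n\mid\rho_1'(X)+\rho_2'(X)<\dim X\}$, $\mathcal{X}_0=\mathcal{X}\cup\{0\}$. Then $\mathcal{M}_1\oplus\mathcal{M}_2=(\mathbb{F}^n,\rho)$ with $\rho(V)=\dim V+\min_{X\in\mathcal{X}_0,\,X\le V}(\rho_1'(X)+\rho_2'(X)-\dim X)$. *)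

theory Defs
  imports "Jordan_Normal_Form.DL_Rank" "HOL-Library.Cardinality"
begin

definition subspaces :: "nat \<Rightarrow> 'a::field vec set set" where
  "subspaces n = {V. VectorSpace.subspace class_ring V (module_vec TYPE('a) n)}"

definition sdim :: "nat \<Rightarrow> 'a::field vec set \<Rightarrow> nat" where
  "sdim n V = vectorspace.dim class_ring ((module_vec TYPE('a) n)\<lparr>carrier := V\<rparr>)"

text \<open>A \<open>q\<close>-matroid \<open>(F\<^sup>n, \<rho>)\<close> is given by \<open>n\<close> and \<open>\<rho>\<close>; only the values of \<open>\<rho>\<close>
  on subspaces of \<open>F\<^sup>n\<close> are meaningful, so equality has to be \<open>qm_eq\<close> rather than \<open>=\<close>.\<close>

definition q_matroid :: "nat \<Rightarrow> ('a::{field,finite} vec set \<Rightarrow> nat) \<Rightarrow> bool" where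
  "q_matroid n \<rho> \<longleftrightarrow>
     (\<forall>V \<in> subspaces n. \<rho> V \<le> sdim n V) \<and>
     (\<forall>V \<in> subspaces n. \<forall>W \<in> subspaces n. V \<subseteq> W \<longrightarrow> \<rho> V \<le> \<rho> W) \<and>
     (\<forall>V \<in> subspaces n. \<forall>W \<in> subspaces n.
        \<rho> {v + w | v w. v \<in> V \<and> w \<in> W} + \<rho> (V \<inter> W) \<le> \<rho> V + \<rho> W)"

definition qm_rank :: "nat \<Rightarrow> ('a::{field,finite} vec set \<Rightarrow> nat) \<Rightarrow> nat" where
  "qm_rank n \<rho> = \<rho> (carrier_vec n)"

definition qm_eq ::
  "nat \<Rightarrow> ('a::{field,finite} vec set \<Rightarrow> nat) \<Rightarrow> ('a vec set \<Rightarrow> nat) \<Rightarrow> bool" where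
  "qm_eq n \<rho> \<rho>' \<longleftrightarrow> (\<forall>V \<in> subspaces n. \<rho> V = \<rho>' V)"

text \<open>In the following, \<open>\<iota>\<close> is the embedding of \<open>F\<^sub>q\<close> into \<open>F\<^bsub>q^m\<^esub>\<close>. The choice of \<open>Y\<close> in
  \<open>mat_rho\<close> is immaterial, see \<open>mat_rho_eq\<close> and \<open>ex_row_space\<close> below; the rank
  of \<open>G\<close> automatically is the rank of the \<open>q\<close>-matroid it represents, see \<open>qm_rank_mat_rho\<close>.\<close>

definition mat_rho ::
  "('a::{field,finite} \<Rightarrow> 'b::{field,finite}) \<Rightarrow> 'b mat \<Rightarrow> 'a vec set \<Rightarrow> nat" where
  "mat_rho \<iota> G V =
     (let Y = (SOME Y. dim_col Y = dim_col G \<and> vec_space.row_space (dim_col G) Y = V)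
      in vec_space.rank (dim_row G) (G * (map_mat \<iota> Y)\<^sup>T))"

definition representable ::
  "('a::{field,finite} \<Rightarrow> 'b::{field,finite}) \<Rightarrow> nat \<Rightarrow> ('a vec set \<Rightarrow> nat) \<Rightarrow> bool" where
  "representable \<iota> n \<rho> \<longleftrightarrow> (\<exists>G. dim_col G = n \<and> qm_eq n (mat_rho \<iota> G) \<rho>)"

definition sum_rho ::
  "nat \<Rightarrow> nat \<Rightarrow> ('a::{field,finite} vec set \<Rightarrow> nat) \<Rightarrow> ('a vec set \<Rightarrow> nat) \<Rightarrow> 'a vec set \<Rightarrow> nat" where
  "sum_rho n1 n2 \<rho>1 \<rho>2 X = \<rho>1 ((\<lambda>v. vec_first v n1) ` X) + \<rho>2 ((\<lambda>v. vec_last v n2) ` X)"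

definition sum_X0 ::
  "nat \<Rightarrow> nat \<Rightarrow> ('a::{field,finite} vec set \<Rightarrow> nat) \<Rightarrow> ('a vec set \<Rightarrow> nat) \<Rightarrow> 'a vec set set" where
  "sum_X0 n1 n2 \<rho>1 \<rho>2 =
     {X \<in> subspaces (n1 + n2). sum_rho n1 n2 \<rho>1 \<rho>2 X < sdim (n1 + n2) X} \<union> {{0\<^sub>v (n1 + n2)}}"

text \<open>The minimum is taken over a finite nonempty set of integers that are at least \<open>- dim V\<close>,
  hence \<open>nat\<close> does not truncate.\<close>

definition qm_direct_sum ::
  "nat \<Rightarrow> nat \<Rightarrow> ('a::{field,finite} vec set \<Rightarrow> nat) \<Rightarrow> ('a vec set \<Rightarrow> nat) \<Rightarrow> 'a vec set \<Rightarrow> nat" where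
  "qm_direct_sum n1 n2 \<rho>1 \<rho>2 V =
     nat (int (sdim (n1 + n2) V) +
       Min ((\<lambda>X. int (sum_rho n1 n2 \<rho>1 \<rho>2 X) - int (sdim (n1 + n2) X)) `
            {X \<in> sum_X0 n1 n2 \<rho>1 \<rho>2. X \<subseteq> V}))"

lemma col_space_mult_row_space_subset:
  fixes \<iota> :: "'a::{field,finite} \<Rightarrow> 'b::{field,finite}"
  assumes \<iota>: "field_hom \<iota>"
    and Y: "dim_col Y = dim_col G" and Z: "dim_col Z = dim_col G"
    and sub: "vec_space.row_space (dim_col G) Y \<subseteq> vec_space.row_space (dim_col G) Z"
  shows "vec_space.col_space (dim_row G) (G * (map_mat \<iota> Y)\<^sup>T)
    \<subseteq> vec_space.col_space (dim_row G) (G * (map_mat \<iota> Z)\<^sup>T)"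
proof -
  interpret \<iota>: field_hom \<iota> by fact
  let ?n = "dim_col G" and ?k = "dim_row G"
  interpret A: vec_space "TYPE('a)" ?n .
  interpret B: vec_space "TYPE('b)" ?k .
  have Yc: "Y \<in> carrier_mat (dim_row Y) ?n" and Zc: "Z \<in> carrier_mat (dim_row Z) ?n"
    using Y Z by auto
  have "\<exists>a. a \<in> carrier_vec (dim_row Z) \<and> Z\<^sup>T *\<^sub>v a = row Y i" if i: "i < dim_row Y" for i
  proof -
    have "row Y i \<in> set (rows Y)" using i by (metis in_set_conv_nth length_rows nth_rows)
    moreover have "set (rows Y) \<subseteq> carrier_vec ?n" using Y rows_carrier[of Y] by auto
    ultimately have "row Y i \<in> A.row_space Y"
      unfolding A.row_space_def using A.in_own_span by blast
    with sub show ?thesis unfolding A.row_space_eq[OF Zc] by auto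
  qed
  then obtain a where a: "\<And>i. i < dim_row Y \<Longrightarrow> a i \<in> carrier_vec (dim_row Z)"
    and Za: "\<And>i. i < dim_row Y \<Longrightarrow> Z\<^sup>T *\<^sub>v a i = row Y i" by metis
  define C where "C = mat (dim_row Z) (dim_row Y) (\<lambda>(i,j). a j $ i)"
  have C: "C \<in> carrier_mat (dim_row Z) (dim_row Y)" by (simp add: C_def)
  have colC: "col C j = a j" if "j < dim_row Y" for j
    using that a[OF that] by (intro eq_vecI) (auto simp: C_def)
  have ZTc: "Z\<^sup>T \<in> carrier_mat ?n (dim_row Z)"
    using Z by (intro carrier_matI) simp_all
  have YT: "Y\<^sup>T = Z\<^sup>T * C"
  proof (rule mat_col_eqI)
    fix j assume "j < dim_col (Z\<^sup>T * C)"
    then have j: "j < dim_row Y" using C by simp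
    have "col (Z\<^sup>T * C) j = Z\<^sup>T *\<^sub>v col C j"
      by (rule col_mult2[OF ZTc C j])
    then show "col Y\<^sup>T j = col (Z\<^sup>T * C) j"
      by (simp only: col_transpose[OF j] colC[OF j] Za[OF j])
  qed (use Y Z C in auto)
  have tr: "(map_mat \<iota> M)\<^sup>T = map_mat \<iota> M\<^sup>T" for M by (intro eq_matI) auto
  have map: "(map_mat \<iota> Y)\<^sup>T = (map_mat \<iota> Z)\<^sup>T * map_mat \<iota> C"
    unfolding tr YT by (rule \<iota>.mat_hom_mult[OF ZTc C])
  let ?GY = "G * (map_mat \<iota> Y)\<^sup>T" and ?GZ = "G * (map_mat \<iota> Z)\<^sup>T"
  have G: "G \<in> carrier_mat ?k ?n" by auto
  have ZT: "(map_mat \<iota> Z)\<^sup>T \<in> carrier_mat ?n (dim_row Z)"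
    using Z by (intro carrier_matI) simp_all
  have Ci: "map_mat \<iota> C \<in> carrier_mat (dim_row Z) (dim_row Y)" using C by simp
  have GY: "?GY \<in> carrier_mat ?k (dim_row Y)" and GZ: "?GZ \<in> carrier_mat ?k (dim_row Z)"
    by (intro carrier_matI; simp)+
  have eq: "?GY = ?GZ * map_mat \<iota> C"
    unfolding map by (rule assoc_mult_mat[OF G ZT Ci, symmetric])
  show ?thesis
  proof
    fix y assume "y \<in> B.col_space ?GY"
    then obtain x where x: "x \<in> carrier_vec (dim_row Y)" "?GY *\<^sub>v x = y"
      unfolding B.col_space_eq[OF GY] by auto
    have "y = ?GZ *\<^sub>v (map_mat \<iota> C *\<^sub>v x)"
      using x assoc_mult_mat_vec[OF GZ Ci x(1)] eq by simp
    moreover have "map_mat \<iota> C *\<^sub>v x \<in> carrier_vec (dim_row Z)" using Ci x(1) by auto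
    ultimately show "y \<in> B.col_space ?GZ"
      unfolding B.col_space_eq[OF GZ] using GZ by auto
  qed
qed

lemma mat_rho_eq:
  fixes \<iota> :: "'a::{field,finite} \<Rightarrow> 'b::{field,finite}"
  assumes "field_hom \<iota>"
    and "dim_col Y = dim_col G" and "vec_space.row_space (dim_col G) Y = V"
  shows "mat_rho \<iota> G V = vec_space.rank (dim_row G) (G * (map_mat \<iota> Y)\<^sup>T)"
proof -
  let ?P = "\<lambda>Y. dim_col Y = dim_col G \<and> vec_space.row_space (dim_col G) Y = V"
  define Z where "Z = (SOME Y. ?P Y)"
  have Z: "?P Z" unfolding Z_def by (rule someI[of ?P Y]) (use assms in simp)
  have "vec_space.col_space (dim_row G) (G * (map_mat \<iota> Z)\<^sup>T)
      = vec_space.col_space (dim_row G) (G * (map_mat \<iota> Y)\<^sup>T)"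
    using col_space_mult_row_space_subset[OF assms(1)] assms Z by (metis subset_antisym order_refl)
  then show ?thesis
    unfolding mat_rho_def Let_def Z_def[symmetric] vec_space.rank_def vec_space.col_space_def
    by simp
qed

lemma qm_rank_mat_rho:
  fixes \<iota> :: "'a::{field,finite} \<Rightarrow> 'b::{field,finite}"
  assumes "field_hom \<iota>" and n: "dim_col G = n"
  shows "qm_rank n (mat_rho \<iota> G) = vec_space.rank (dim_row G) G"
proof -
  interpret \<iota>: field_hom \<iota> by fact
  interpret A: vec_space "TYPE('a)" n .
  have "v \<in> A.row_space (1\<^sub>m n)" if v: "v \<in> carrier_vec n" for v
    unfolding A.row_space_eq[OF one_carrier_mat] using v by simp
  moreover have "A.row_space (1\<^sub>m n) \<subseteq> carrier_vec n"
    unfolding A.row_space_eq[OF one_carrier_mat] by auto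
  ultimately have "A.row_space (1\<^sub>m n) = carrier_vec n" by blast
  then have "mat_rho \<iota> G (carrier_vec n)
      = vec_space.rank (dim_row G) (G * (map_mat \<iota> (1\<^sub>m n))\<^sup>T)"
    by (intro mat_rho_eq assms(1)) (simp_all add: n)
  moreover have "(map_mat \<iota> (1\<^sub>m n))\<^sup>T = 1\<^sub>m n" by (simp add: \<iota>.mat_hom_one)
  moreover have "G * 1\<^sub>m n = G" by (rule right_mult_one_mat) (use n in auto)
  ultimately show ?thesis unfolding qm_rank_def by metis
qed

lemma ex_row_space:
  fixes V :: "'a::{field,finite} vec set"
  assumes V: "V \<in> subspaces n"
  shows "\<exists>Y. dim_col Y = n \<and> vec_space.row_space n Y = V"
proof -
  interpret A: vec_space "TYPE('a)" n .
  have sub: "submodule class_ring V A.V" and Vc: "V \<subseteq> carrier_vec n"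
    using V unfolding subspaces_def VectorSpace.subspace_def submodule_def by auto
  have "finite (carrier_vec n :: 'a vec set)"
  proof -
    have "carrier_vec n = vec_of_list ` {xs :: 'a list. set xs \<subseteq> UNIV \<and> length xs = n}"
    proof (intro equalityI subsetI)
      fix v :: "'a vec" assume "v \<in> carrier_vec n"
      then show "v \<in> vec_of_list ` {xs. set xs \<subseteq> UNIV \<and> length xs = n}"
        by (intro image_eqI[of _ _ "list_of_vec v"]) (auto simp: vec_list)
    qed (auto intro!: carrier_vecI)
    then show ?thesis using finite_lists_length_eq[of "UNIV :: 'a set" n] by simp
  qed
  with Vc have "finite V" by (rule finite_subset)
  then obtain vs where vs: "set vs = V" using finite_list by blast
  have "rows (mat_of_rows n vs) = vs" using vs Vc by (intro rows_mat_of_rows) simp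
  moreover have "A.span V = V"
    using A.span_is_subset[OF _ sub] A.in_own_span[of V] Vc by auto
  ultimately have "A.row_space (mat_of_rows n vs) = V"
    unfolding A.row_space_def using vs by simp
  then show ?thesis by (intro exI[of _ "mat_of_rows n vs"]) simp
qed

end

theory Submission
  imports Defs
begin

text \<open>Write a representing matrix of the direct sum as \<open>G = (A | B)\<close>. On a product subspace
  \<open>V\<^sub>1 \<oplus> V\<^sub>2\<close> the direct sum has rank \<open>\<rho>\<^sub>1 V\<^sub>1 + \<rho>\<^sub>2 V\<^sub>2\<close>, because passing from a subspace to a larger one
  raises the rank of a \<open>q\<close>-matroid by at most the codimension. Taking \<open>V\<^sub>2 = 0\<close> or \<open>V\<^sub>1 = 0\<close>, it follows
  that \<open>A\<close> represents \<open>\<rho>\<^sub>1\<close> and \<open>B\<close> represents \<open>\<rho>\<^sub>2\<close>; taking the whole space,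
  \<open>rk G = k\<^sub>1 + k\<^sub>2 = rk A + rk B\<close>. Rank factorizations \<open>A = L\<^sub>1 G\<^sub>1\<close> and \<open>B = L\<^sub>2 G\<^sub>2\<close> give
  \<open>G = (L\<^sub>1 | L\<^sub>2) diag(G\<^sub>1, G\<^sub>2)\<close>, where \<open>(L\<^sub>1 | L\<^sub>2)\<close> has \<open>k\<^sub>1 + k\<^sub>2 = rk G\<close> columns and hence is injective;
  cancelling an injective left factor does not change the represented \<open>q\<close>-matroid.
  Since the fields are finite, dimensions are compared by counting vectors.\<close>

section \<open>Subspaces, and dimension as a count of vectors\<close>

lemma subspaces_iff:
  fixes V :: "'a::field vec set"
  shows "V \<in> subspaces n \<longleftrightarrow> V \<subseteq> carrier_vec n \<and> 0\<^sub>v n \<in> V \<and>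
    (\<forall>v\<in>V. \<forall>w\<in>V. v + w \<in> V) \<and> (\<forall>c. \<forall>v\<in>V. c \<cdot>\<^sub>v v \<in> V)"
proof -
  interpret vec_space "TYPE('a)" n .
  show ?thesis
    unfolding subspaces_def VectorSpace.subspace_def submodule_def
    using vec_vs[where 'a='a] module_axioms by (auto simp: module_vec_simps)
qed

lemma subspaces_subset: "V \<in> subspaces n \<Longrightarrow> V \<subseteq> carrier_vec n"
  by (simp add: subspaces_iff)

lemma subspaces_zero: "V \<in> subspaces n \<Longrightarrow> 0\<^sub>v n \<in> V"
  by (simp add: subspaces_iff)

lemma carrier_subspace: "carrier_vec n \<in> subspaces n"
  by (simp add: subspaces_iff)

lemma zero_subspace: "{0\<^sub>v n} \<in> subspaces n"
  by (auto simp: subspaces_iff)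

lemma subspace_basis:
  fixes V :: "'a::{field,finite} vec set"
  assumes V: "V \<in> subspaces n"
  obtains \<beta> where "finite \<beta>" "\<beta> \<subseteq> V" "card \<beta> = sdim n V"
    "LinearCombinations.module.span class_ring (module_vec TYPE('a) n) \<beta> = V"
    "vectorspace.basis class_ring ((module_vec TYPE('a) n)\<lparr>carrier := V\<rparr>) \<beta>"
proof -
  interpret A: vec_space "TYPE('a)" n .
  have sub: "VectorSpace.subspace class_ring V A.V" using V by (simp add: subspaces_def)
  interpret W: vectorspace class_ring "A.vs V" by (rule A.subspace_is_vs[OF sub])
  \<comment> \<open>A matrix with row space \<open>V\<close> supplies a finite spanning set, which
    is what finite dimension asks for.\<close>
  obtain Y where Y: "dim_col Y = n" "A.row_space Y = V" using ex_row_space[OF V] by blast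
  have "W.fin_dim"
    unfolding Y(2)[symmetric] A.row_space_def
    using Y(1) rows_carrier[of Y] by (intro A.fin_dim_span) auto
  then obtain \<beta> where \<beta>: "finite \<beta>" "W.basis \<beta>" using W.finite_basis_exists by blast
  have "card \<beta> = sdim n V" using W.dim_basis[OF \<beta>] by (simp add: sdim_def)
  moreover have bV: "\<beta> \<subseteq> V" using \<beta>(2) by (simp add: W.basis_def)
  \<comment> \<open>\<open>W.basis\<close> speaks of the span formed inside \<open>V\<close>; for a
    subset of \<open>V\<close> it agrees with the span in the ambient space.\<close>
  moreover have "A.span \<beta> = V"
    using A.span_li_not_depend(1)[OF bV A.is_module[OF sub]] \<beta>(2) by (simp add: W.basis_def)
  ultimately show ?thesis using \<beta> that by blast
qed

text \<open>Coordinates with respect to a basis identify \<open>V\<close> with the functions from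
  the basis to the field. As the field has more than one element, the exponent can be read off from
  the cardinality, so dimensions can be compared by counting.\<close>

lemma card_subspace:
  fixes V :: "'a::{field,finite} vec set"
  assumes V: "V \<in> subspaces n"
  shows "card V = CARD('a) ^ sdim n V"
proof -
  interpret A: vec_space "TYPE('a)" n .
  have sub: "VectorSpace.subspace class_ring V A.V" using V by (simp add: subspaces_def)
  interpret W: vectorspace class_ring "A.vs V" by (rule A.subspace_is_vs[OF sub])
  obtain \<beta> where \<beta>: "finite \<beta>" "\<beta> \<subseteq> V" "card \<beta> = sdim n V" "W.basis \<beta>"
    using subspace_basis[OF V] by blast
  \<comment> \<open>Outside \<open>\<beta>\<close> these functions are fixed to be
    \<open>undefined\<close>, so that each vector has exactly one coordinate function.\<close>
  let ?P = "\<beta> \<rightarrow>\<^sub>E (UNIV :: 'a set)"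
  have ex: "\<forall>v\<in>V. \<exists>!a. a \<in> ?P \<and> W.lincomb a \<beta> = v"
    using W.basis_criterion[OF \<beta>(1)] \<beta> by (simp add: class_ring_simps)
  have "bij_betw (\<lambda>a. W.lincomb a \<beta>) ?P V"
  proof (rule bij_betwI')
    fix a assume "a \<in> ?P"
    show *: "W.lincomb a \<beta> \<in> V"
      using W.lincomb_closed[of \<beta> a] \<beta>(2) by (auto simp: class_ring_simps)
  next
    fix a b assume ab: "a \<in> ?P" "b \<in> ?P"
    have "W.lincomb a \<beta> \<in> V"
      using W.lincomb_closed[of \<beta> a] \<beta>(2) by (auto simp: class_ring_simps)
    with ex ab show "(W.lincomb a \<beta> = W.lincomb b \<beta>) = (a = b)" by metis
  next
    fix v assume "v \<in> V"
    with ex show "\<exists>a\<in>?P. v = W.lincomb a \<beta>" by metis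
  qed
  then have "card V = card ?P" by (simp add: bij_betw_same_card)
  then show ?thesis using \<beta> by (simp add: card_PiE)
qed

lemma card_field_gt_1: "1 < CARD('a::{field,finite})"
proof -
  have "card {0, 1::'a} \<le> CARD('a)" by (intro card_mono) auto
  then show ?thesis by simp
qed

text \<open>An infinite set would have cardinality 0, whereas the count just obtained is a positive
  power.\<close>

lemma finite_carrier_vec: "finite (carrier_vec n :: 'a::{field,finite} vec set)"
  using card_subspace[OF carrier_subspace[of n, where 'a='a]] card_field_gt_1[where 'a='a]
  by (intro card_ge_0_finite) simp

lemma finite_subspace: "V \<in> subspaces n \<Longrightarrow> finite (V :: 'a::{field,finite} vec set)"
  using finite_carrier_vec subspaces_subset finite_subset by metis

lemma sdim_carrier: "sdim n (carrier_vec n :: 'a::{field,finite} vec set) = n"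
proof -
  interpret vec_space "TYPE('a)" n .
  have "V\<lparr>carrier := carrier_vec n\<rparr> = V" by (simp add: module_vec_def)
  then show ?thesis unfolding sdim_def by (simp only: dim_is_n)
qed

lemma card_carrier_vec: "card (carrier_vec n :: 'a::{field,finite} vec set) = CARD('a) ^ n"
  by (simp add: card_subspace[OF carrier_subspace] sdim_carrier)

lemma sdim_zero: "sdim n {0\<^sub>v n :: 'a::{field,finite} vec} = 0"
  using card_subspace[OF zero_subspace[where 'a='a], of n] card_field_gt_1[where 'a='a]
  by (cases "sdim n {0\<^sub>v n :: 'a vec}") auto

lemma sdim_le_iff:
  fixes V :: "'a::{field,finite} vec set"
  assumes "V \<in> subspaces n"
  shows "sdim n V \<le> d \<longleftrightarrow> card V \<le> CARD('a) ^ d"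
  using card_field_gt_1[where 'a='a] by (simp add: card_subspace[OF assms])

lemma sdim_strict_mono:
  fixes V W :: "'a::{field,finite} vec set"
  assumes "V \<in> subspaces n" "W \<in> subspaces n" "V \<subset> W"
  shows "sdim n V < sdim n W"
  using psubset_card_mono[OF finite_subspace[OF assms(2)] assms(3)] card_field_gt_1[where 'a='a]
  unfolding card_subspace[OF assms(1)] card_subspace[OF assms(2)] by simp

lemma sdim_mono:
  fixes V W :: "'a::{field,finite} vec set"
  assumes "V \<in> subspaces n" "W \<in> subspaces n" "V \<subseteq> W"
  shows "sdim n V \<le> sdim n W"
proof (cases "V = W")
  case False
  then have "V \<subset> W" using assms(3) by blast
  then show ?thesis using sdim_strict_mono[OF assms(1,2)] by (intro less_imp_le)
qed simp

section \<open>Sums, lines and the growth of rank\<close>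

lemma sum_subspace:
  assumes V: "V \<in> subspaces n" and W: "W \<in> subspaces n"
  shows "{v + w | v w. v \<in> V \<and> w \<in> W} \<in> subspaces n"
  unfolding subspaces_iff
proof (intro conjI ballI allI)
  have c: "v \<in> carrier_vec n" if "v \<in> V \<or> v \<in> W" for v using that V W subspaces_subset by blast
  let ?S = "{v + w | v w. v \<in> V \<and> w \<in> W}"
  show "?S \<subseteq> carrier_vec n" using c by auto
  show "0\<^sub>v n \<in> ?S"
    using subspaces_zero[OF V] subspaces_zero[OF W] by (intro CollectI exI[of _ "0\<^sub>v n"]) auto
  fix x assume "x \<in> ?S"
  then obtain v w where x: "x = v + w" "v \<in> V" "w \<in> W" by blast
  { fix y assume "y \<in> ?S"
    then obtain v' w' where y: "y = v' + w'" "v' \<in> V" "w' \<in> W" by blast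
    have "x + y = (v + v') + (w + w')"
      using c[of v] c[of w] c[of v'] c[of w'] x y by (intro eq_vecI) auto
    then show "x + y \<in> ?S" using x y V W unfolding subspaces_iff by blast }
  fix a
  have "a \<cdot>\<^sub>v x = a \<cdot>\<^sub>v v + a \<cdot>\<^sub>v w" unfolding x(1)
    using c[of v] c[of w] x by (intro smult_add_distrib_vec[where n=n]) auto
  then show "a \<cdot>\<^sub>v x \<in> ?S" using x V W unfolding subspaces_iff by blast
qed

lemma line_subspace:
  assumes "v \<in> carrier_vec n"
  shows "range (\<lambda>c. c \<cdot>\<^sub>v v) \<in> subspaces n"
  unfolding subspaces_iff
proof (intro conjI ballI allI)
  show "0\<^sub>v n \<in> range (\<lambda>c. c \<cdot>\<^sub>v v)" using assms by (intro range_eqI[of _ _ 0]) auto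
qed (use assms in \<open>auto simp: add_smult_distrib_vec[symmetric] smult_smult_assoc\<close>)

text \<open>Enlarge \<open>X\<close> one vector at a time, by induction on the codimension in
  \<open>V\<close>. Adjoining the line through a vector outside \<open>X\<close> increases the
  dimension, while by submodularity the rank grows by at most the rank of that line, which is at
  most one.\<close>

lemma q_matroid_increment:
  fixes \<rho> :: "'a::{field,finite} vec set \<Rightarrow> nat"
  assumes q: "q_matroid n \<rho>" and V: "V \<in> subspaces n"
  shows "X \<in> subspaces n \<Longrightarrow> X \<subseteq> V \<Longrightarrow> \<rho> V + sdim n X \<le> \<rho> X + sdim n V"
proof (induction "sdim n V - sdim n X" arbitrary: X rule: less_induct)
  case less
  note X = less.prems(1)
  show ?case
  proof (cases "X = V")
    case False
    then obtain v where v: "v \<in> V" "v \<notin> X" using less.prems by blast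
    have vc: "v \<in> carrier_vec n" using v V subspaces_subset by blast
    define W where "W = range (\<lambda>c. c \<cdot>\<^sub>v v)"
    define X' where "X' = {x + w | x w. x \<in> X \<and> w \<in> W}"
    have W: "W \<in> subspaces n" unfolding W_def by (rule line_subspace[OF vc])
    have X': "X' \<in> subspaces n" unfolding X'_def by (rule sum_subspace[OF X W])
    have XX': "X \<subseteq> X'"
    proof
      fix x assume "x \<in> X"
      then show "x \<in> X'" unfolding X'_def using subspaces_zero[OF W] subspaces_subset[OF X]
        by (intro CollectI exI[of _ x] exI[of _ "0\<^sub>v n"]) auto
    qed
    have "v = 0\<^sub>v n + 1 \<cdot>\<^sub>v v" using vc by simp
    then have "v \<in> X'" unfolding X'_def W_def using subspaces_zero[OF X] by blast
    with v XX' have lt: "sdim n X < sdim n X'" using X X' by (intro sdim_strict_mono) auto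
    have X'V: "X' \<subseteq> V" using less.prems v V unfolding X'_def W_def subspaces_iff by blast
    \<comment> \<open>Together these give \<open>sdim n X < sdim n V\<close>, so the truncated
      difference really decreases.\<close>
    from lt sdim_mono[OF X' V X'V] have "sdim n V - sdim n X' < sdim n V - sdim n X" by linarith
    then have "\<rho> V + sdim n X' \<le> \<rho> X' + sdim n V" by (rule less.hyps[OF _ X' X'V])
    \<comment> \<open>A line is an image of the field, so counting bounds its dimension by
      one.\<close>
    moreover have "card W \<le> CARD('a)" unfolding W_def by (intro card_image_le) simp
    then have "sdim n W \<le> 1" using sdim_le_iff[OF W, of 1] by simp
    moreover have "\<rho> W \<le> sdim n W" and "\<rho> X' + \<rho> (X \<inter> W) \<le> \<rho> X + \<rho> W"
      using q X W unfolding q_matroid_def X'_def by blast+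
    ultimately show ?thesis using lt by linarith
  qed simp
qed

section \<open>Product subspaces and the two projections\<close>

definition vec_prod :: "'a vec set \<Rightarrow> 'a vec set \<Rightarrow> 'a vec set" where
  "vec_prod V W = (\<lambda>(v, w). v @\<^sub>v w) ` (V \<times> W)"

lemma smult_append_vec: "c \<cdot>\<^sub>v (v @\<^sub>v w) = c \<cdot>\<^sub>v v @\<^sub>v c \<cdot>\<^sub>v w"
  by (intro eq_vecI) auto

lemma vec_prod_subspace:
  assumes V: "V \<in> subspaces n1" and W: "W \<in> subspaces n2"
  shows "vec_prod V W \<in> subspaces (n1 + n2)"
  unfolding subspaces_iff
proof (intro conjI ballI allI)
  have c: "v \<in> V \<Longrightarrow> v \<in> carrier_vec n1" "w \<in> W \<Longrightarrow> w \<in> carrier_vec n2" for v w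
    using V W subspaces_subset by blast+
  show "vec_prod V W \<subseteq> carrier_vec (n1 + n2)" using c unfolding vec_prod_def by auto
  have "0\<^sub>v (n1 + n2) = 0\<^sub>v n1 @\<^sub>v 0\<^sub>v n2" by (intro eq_vecI) auto
  then show "0\<^sub>v (n1 + n2) \<in> vec_prod V W"
    using subspaces_zero[OF V] subspaces_zero[OF W] unfolding vec_prod_def
    by (intro image_eqI[of _ _ "(0\<^sub>v n1, 0\<^sub>v n2)"]) auto
  fix x assume "x \<in> vec_prod V W"
  then obtain v w where x: "x = v @\<^sub>v w" "v \<in> V" "w \<in> W" unfolding vec_prod_def by auto
  { fix y assume "y \<in> vec_prod V W"
    then obtain v' w' where y: "y = v' @\<^sub>v w'" "v' \<in> V" "w' \<in> W" unfolding vec_prod_def by auto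
    have "x + y = (v + v') @\<^sub>v (w + w')" unfolding x(1) y(1)
      by (rule append_vec_add[OF c(1)[OF x(2)] c(1)[OF y(2)] c(2)[OF x(3)] c(2)[OF y(3)]])
    moreover have "v + v' \<in> V" "w + w' \<in> W" using x y V W unfolding subspaces_iff by blast+
    ultimately show "x + y \<in> vec_prod V W" unfolding vec_prod_def by auto }
  fix a
  have "a \<cdot>\<^sub>v v \<in> V" "a \<cdot>\<^sub>v w \<in> W" using x V W unfolding subspaces_iff by blast+
  then show "a \<cdot>\<^sub>v x \<in> vec_prod V W" unfolding vec_prod_def x(1) smult_append_vec by auto
qed

lemma vec_first_append: "v \<in> carrier_vec n1 \<Longrightarrow> vec_first (v @\<^sub>v w) n1 = v"
  unfolding vec_first_def by (intro eq_vecI) auto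

lemma vec_last_append:
  "v \<in> carrier_vec n1 \<Longrightarrow> w \<in> carrier_vec n2 \<Longrightarrow> vec_last (v @\<^sub>v w) n2 = w"
  unfolding vec_last_def by (intro eq_vecI) auto

text \<open>Concatenation is injective on \<open>V \<times> W\<close> because the cut is fixed at
  position \<open>n1\<close>; hence cardinalities multiply and exponents add.\<close>

lemma sdim_vec_prod:
  fixes V W :: "'a::{field,finite} vec set"
  assumes V: "V \<in> subspaces n1" and W: "W \<in> subspaces n2"
  shows "sdim (n1 + n2) (vec_prod V W) = sdim n1 V + sdim n2 W"
proof -
  have "inj_on (\<lambda>(v, w). v @\<^sub>v w) (V \<times> W)"
    using subspaces_subset[OF V] by (intro inj_onI) (auto simp: append_vec_eq[where n=n1] subset_iff)
  then have "card (vec_prod V W) = card V * card W"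
    unfolding vec_prod_def by (simp add: card_image card_cartesian_product)
  then have "CARD('a) ^ sdim (n1 + n2) (vec_prod V W) = CARD('a) ^ (sdim n1 V + sdim n2 W)"
    using V W vec_prod_subspace[OF V W] by (simp add: card_subspace power_add)
  then show ?thesis using card_field_gt_1[where 'a='a] by simp
qed

lemma vec_first_subspace:
  assumes X: "X \<in> subspaces (n1 + n2)"
  shows "(\<lambda>v. vec_first v n1) ` X \<in> subspaces n1"
  unfolding subspaces_iff
proof (intro conjI ballI allI)
  have c: "\<And>x. x \<in> X \<Longrightarrow> dim_vec x = n1 + n2" using subspaces_subset[OF X] by auto
  have "0\<^sub>v n1 = vec_first (0\<^sub>v (n1 + n2)) n1" unfolding vec_first_def by (intro eq_vecI) auto
  then show "0\<^sub>v n1 \<in> (\<lambda>v. vec_first v n1) ` X" using subspaces_zero[OF X] by blast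
  fix x assume "x \<in> (\<lambda>v. vec_first v n1) ` X"
  then obtain x' where x: "x' \<in> X" "x = vec_first x' n1" by blast
  { fix y assume "y \<in> (\<lambda>v. vec_first v n1) ` X"
    then obtain y' where y: "y' \<in> X" "y = vec_first y' n1" by blast
    have "x + y = vec_first (x' + y') n1"
      using x y c unfolding vec_first_def by (intro eq_vecI) auto
    then show "x + y \<in> (\<lambda>v. vec_first v n1) ` X" using x y X unfolding subspaces_iff by blast }
  fix a
  have "a \<cdot>\<^sub>v x = vec_first (a \<cdot>\<^sub>v x') n1"
    using x c unfolding vec_first_def by (intro eq_vecI) auto
  then show "a \<cdot>\<^sub>v x \<in> (\<lambda>v. vec_first v n1) ` X" using x X unfolding subspaces_iff by blast
qed auto

lemma vec_last_subspace:
  assumes X: "X \<in> subspaces (n1 + n2)"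
  shows "(\<lambda>v. vec_last v n2) ` X \<in> subspaces n2"
  unfolding subspaces_iff
proof (intro conjI ballI allI)
  have c: "\<And>x. x \<in> X \<Longrightarrow> dim_vec x = n1 + n2" using subspaces_subset[OF X] by auto
  have "0\<^sub>v n2 = vec_last (0\<^sub>v (n1 + n2)) n2" unfolding vec_last_def by (intro eq_vecI) auto
  then show "0\<^sub>v n2 \<in> (\<lambda>v. vec_last v n2) ` X" using subspaces_zero[OF X] by blast
  fix x assume "x \<in> (\<lambda>v. vec_last v n2) ` X"
  then obtain x' where x: "x' \<in> X" "x = vec_last x' n2" by blast
  { fix y assume "y \<in> (\<lambda>v. vec_last v n2) ` X"
    then obtain y' where y: "y' \<in> X" "y = vec_last y' n2" by blast
    have "x + y = vec_last (x' + y') n2"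
      using x y c unfolding vec_last_def by (intro eq_vecI) auto
    then show "x + y \<in> (\<lambda>v. vec_last v n2) ` X" using x y X unfolding subspaces_iff by blast }
  fix a
  have "a \<cdot>\<^sub>v x = vec_last (a \<cdot>\<^sub>v x') n2"
    using x c unfolding vec_last_def by (intro eq_vecI) auto
  then show "a \<cdot>\<^sub>v x \<in> (\<lambda>v. vec_last v n2) ` X" using x X unfolding subspaces_iff by blast
qed auto

text \<open>A subspace is in general not a product. This inclusion serves to bound its dimension by
  the sum of the dimensions of its projections.\<close>

lemma subset_vec_prod_projections:
  assumes "X \<in> subspaces (n1 + n2)"
  shows "X \<subseteq> vec_prod ((\<lambda>v. vec_first v n1) ` X) ((\<lambda>v. vec_last v n2) ` X)"
proof
  fix x assume x: "x \<in> X"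
  then have "vec_first x n1 @\<^sub>v vec_last x n2 = x" using subspaces_subset[OF assms] by auto
  then show "x \<in> vec_prod ((\<lambda>v. vec_first v n1) ` X) ((\<lambda>v. vec_last v n2) ` X)"
    unfolding vec_prod_def using x
    by (intro image_eqI[of _ _ "(vec_first x n1, vec_last x n2)"]) auto
qed

lemma vec_first_vec_prod:
  assumes "V \<in> subspaces n1" "W \<in> subspaces n2"
  shows "(\<lambda>v. vec_first v n1) ` vec_prod V W = V"
proof -
  have "vec_first (v @\<^sub>v w) n1 = v" if "v \<in> V" for v w
    using that subspaces_subset[OF assms(1)] by (intro vec_first_append) auto
  then have "(\<lambda>v. vec_first v n1) ` vec_prod V W = fst ` (V \<times> W)"
    unfolding vec_prod_def image_image by (intro image_cong) auto
  also have "\<dots> = V" using subspaces_zero[OF assms(2)] by auto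
  finally show ?thesis .
qed

lemma vec_last_vec_prod:
  assumes "V \<in> subspaces n1" "W \<in> subspaces n2"
  shows "(\<lambda>v. vec_last v n2) ` vec_prod V W = W"
proof -
  have "vec_last (v @\<^sub>v w) n2 = w" if "v \<in> V" "w \<in> W" for v w
    using that subspaces_subset[OF assms(1)] subspaces_subset[OF assms(2)]
    by (intro vec_last_append) auto
  then have "(\<lambda>v. vec_last v n2) ` vec_prod V W = snd ` (V \<times> W)"
    unfolding vec_prod_def image_image by (intro image_cong) auto
  also have "\<dots> = W" using subspaces_zero[OF assms(1)] by auto
  finally show ?thesis .
qed

section \<open>The direct sum on product subspaces\<close>

lemma q_matroid_zero: "q_matroid n \<rho> \<Longrightarrow> \<rho> {0\<^sub>v n} = 0"
  unfolding q_matroid_def using zero_subspace sdim_zero by (metis le_zero_eq)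

text \<open>The expression to be minimized takes its least value over all subspaces of the product
  at the product itself, and there it cancels the dimension and leaves the sum of the two ranks.
  What remains is that this value is also attained on the restricted family
  \<open>sum_X0\<close>.\<close>

lemma qm_direct_sum_vec_prod:
  fixes \<rho>1 \<rho>2 :: "'a::{field,finite} vec set \<Rightarrow> nat"
  assumes q1: "q_matroid n1 \<rho>1" and q2: "q_matroid n2 \<rho>2"
    and V1: "V1 \<in> subspaces n1" and V2: "V2 \<in> subspaces n2"
  shows "qm_direct_sum n1 n2 \<rho>1 \<rho>2 (vec_prod V1 V2) = \<rho>1 V1 + \<rho>2 V2"
proof -
  let ?n = "n1 + n2" and ?V = "vec_prod V1 V2"
  let ?f = "\<lambda>X. int (sum_rho n1 n2 \<rho>1 \<rho>2 X) - int (sdim ?n X)"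
  let ?S = "{X \<in> sum_X0 n1 n2 \<rho>1 \<rho>2. X \<subseteq> ?V}"
  let ?d = "int (\<rho>1 V1 + \<rho>2 V2) - int (sdim ?n ?V)"
  have V: "?V \<in> subspaces ?n" by (rule vec_prod_subspace[OF V1 V2])
  have fV: "?f ?V = ?d"
    unfolding sum_rho_def vec_first_vec_prod[OF V1 V2] vec_last_vec_prod[OF V1 V2] by simp
  have sub: "X \<in> subspaces ?n" if "X \<in> sum_X0 n1 n2 \<rho>1 \<rho>2" for X
    using that zero_subspace unfolding sum_X0_def by auto
  have f0: "?f {0\<^sub>v ?n} = 0"
  proof -
    have "vec_first (0\<^sub>v ?n :: 'a vec) n1 = 0\<^sub>v n1" "vec_last (0\<^sub>v ?n :: 'a vec) n2 = 0\<^sub>v n2"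
      unfolding vec_first_def vec_last_def by (intro eq_vecI; simp)+
    then show ?thesis by (simp add: sum_rho_def sdim_zero q_matroid_zero[OF q1] q_matroid_zero[OF q2])
  qed
  \<comment> \<open>The increment bound is applied to each projection of \<open>X\<close>; the
    dimension of \<open>X\<close> is at most the sum of those of its projections.\<close>
  have le: "?d \<le> ?f X" if X: "X \<in> subspaces ?n" and XV: "X \<subseteq> ?V" for X
  proof -
    let ?X1 = "(\<lambda>v. vec_first v n1) ` X" and ?X2 = "(\<lambda>v. vec_last v n2) ` X"
    have X1: "?X1 \<in> subspaces n1" and X2: "?X2 \<in> subspaces n2"
      using X by (rule vec_first_subspace, rule vec_last_subspace)
    have "?X1 \<subseteq> V1" using XV vec_first_vec_prod[OF V1 V2] by blast
    moreover have "?X2 \<subseteq> V2" using XV vec_last_vec_prod[OF V1 V2] by blast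
    ultimately have "\<rho>1 V1 + sdim n1 ?X1 \<le> \<rho>1 ?X1 + sdim n1 V1"
      "\<rho>2 V2 + sdim n2 ?X2 \<le> \<rho>2 ?X2 + sdim n2 V2"
      using q_matroid_increment[OF q1 V1 X1] q_matroid_increment[OF q2 V2 X2] by auto
    moreover have "sdim ?n X \<le> sdim n1 ?X1 + sdim n2 ?X2"
      using sdim_mono[OF X vec_prod_subspace[OF X1 X2] subset_vec_prod_projections[OF X]]
      by (simp add: sdim_vec_prod[OF X1 X2])
    ultimately show ?thesis unfolding sum_rho_def sdim_vec_prod[OF V1 V2] by linarith
  qed
  have "?S \<subseteq> Pow ?V" by blast
  then have fin: "finite ?S" using finite_subspace[OF V] by (meson finite_Pow_iff finite_subset)
  have zS: "{0\<^sub>v ?n} \<in> ?S" using subspaces_zero[OF V] unfolding sum_X0_def by auto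
  have "?d \<in> ?f ` ?S"
  proof (cases "?V \<in> sum_X0 n1 n2 \<rho>1 \<rho>2")
    case True
    then have "?V \<in> ?S" by simp
    then show ?thesis using fV by (intro image_eqI[where x="?V"]) auto
  next
    case False
    \<comment> \<open>If the product is not in the family, its rank sum is at least its dimension.
      Comparison with the zero subspace, where the expression is 0, forces \<open>?d = 0\<close>, so
      the zero subspace attains the value.\<close>
    then have "?d \<ge> 0" using V fV unfolding sum_X0_def by auto
    moreover have "?d \<le> 0" using le[OF zero_subspace] zS f0 by simp
    ultimately show ?thesis using f0 zS by (intro image_eqI[where x="{0\<^sub>v ?n}"]) auto
  qed
  then have "Min (?f ` ?S) = ?d" using fin le sub by (intro Min_eqI) auto
  then show ?thesis unfolding qm_direct_sum_def by simp
qed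

section \<open>Matrix rank by counting, and rank factorization\<close>

lemma span_subspace:
  fixes S :: "'a::field vec set"
  assumes "S \<subseteq> carrier_vec n"
  shows "LinearCombinations.module.span class_ring (module_vec TYPE('a) n) S \<in> subspaces n"
proof -
  interpret vec_space "TYPE('a)" n .
  show ?thesis using span_is_subspace[of S] assms by (simp add: subspaces_def)
qed

lemma col_space_image:
  fixes A :: "'a::field mat"
  assumes A: "A \<in> carrier_mat k n"
  shows "vec_space.col_space k A = (\<lambda>x. A *\<^sub>v x) ` carrier_vec n"
  using vec_space.col_space_eq[OF A] A by auto

text \<open>Rank becomes the logarithm of the number of values of the linear map, so the rank
  comparisons below reduce to inclusions and injectivity between finite sets.\<close>

lemma card_col_space:
  fixes A :: "'a::{field,finite} mat"
  assumes A: "A \<in> carrier_mat k n"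
  shows "card ((\<lambda>x. A *\<^sub>v x) ` carrier_vec n) = CARD('a) ^ vec_space.rank k A"
proof -
  interpret vec_space "TYPE('a)" k .
  have "span (set (cols A)) \<in> subspaces k" using cols_dim[of A] A by (intro span_subspace) auto
  then show ?thesis
    unfolding col_space_image[OF A, symmetric] col_space_def
    by (simp add: card_subspace rank_def sdim_def)
qed

lemma mult_mat_image:
  fixes L :: "'a::field mat"
  assumes L: "L \<in> carrier_mat k r" and M: "M \<in> carrier_mat r s"
  shows "(\<lambda>x. (L * M) *\<^sub>v x) ` carrier_vec s = (\<lambda>y. L *\<^sub>v y) ` (\<lambda>x. M *\<^sub>v x) ` carrier_vec s"
  unfolding image_image using assoc_mult_mat_vec[OF L M] by (intro image_cong) auto

lemma rank_mult_le:
  fixes L :: "'a::{field,finite} mat"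
  assumes L: "L \<in> carrier_mat k r" and M: "M \<in> carrier_mat r s"
  shows "vec_space.rank k (L * M) \<le> vec_space.rank k L"
proof -
  have "(\<lambda>x. (L * M) *\<^sub>v x) ` carrier_vec s \<subseteq> (\<lambda>x. L *\<^sub>v x) ` carrier_vec r"
    unfolding mult_mat_image[OF L M] using M by (intro image_mono) auto
  then have "card ((\<lambda>x. (L * M) *\<^sub>v x) ` carrier_vec s) \<le> card ((\<lambda>x. L *\<^sub>v x) ` carrier_vec r)"
    by (intro card_mono finite_imageI finite_carrier_vec)
  then show ?thesis
    unfolding card_col_space[OF mult_carrier_mat[OF L M]] card_col_space[OF L]
    using card_field_gt_1[where 'a='a] by simp
qed

lemma rank_mult_inj:
  fixes L :: "'a::{field,finite} mat"
  assumes L: "L \<in> carrier_mat k r" and M: "M \<in> carrier_mat r s"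
    and inj: "inj_on (\<lambda>x. L *\<^sub>v x) (carrier_vec r)"
  shows "vec_space.rank k (L * M) = vec_space.rank r M"
proof -
  have "(\<lambda>x. M *\<^sub>v x) ` carrier_vec s \<subseteq> carrier_vec r" using M by auto
  then have "card ((\<lambda>x. (L * M) *\<^sub>v x) ` carrier_vec s) = card ((\<lambda>x. M *\<^sub>v x) ` carrier_vec s)"
    unfolding mult_mat_image[OF L M] by (intro card_image inj_on_subset[OF inj])
  then show ?thesis
    unfolding card_col_space[OF mult_carrier_mat[OF L M]] card_col_space[OF M]
    using card_field_gt_1[where 'a='a] by simp
qed

text \<open>The rank of \<open>L\<close> is squeezed between that of \<open>L * M\<close> and its
  number of columns, both equal to \<open>r\<close>. Hence the map has as many values as arguments,
  which on a finite domain means injectivity.\<close>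

lemma inj_on_left_factor:
  fixes L :: "'a::{field,finite} mat"
  assumes L: "L \<in> carrier_mat k r" and M: "M \<in> carrier_mat r s"
    and r: "vec_space.rank k (L * M) = r"
  shows "inj_on (\<lambda>x. L *\<^sub>v x) (carrier_vec r)"
proof -
  have "vec_space.rank k L = r"
    using rank_mult_le[OF L M] vec_space.rank_le_nc[OF L] r by simp
  then have "card ((\<lambda>x. L *\<^sub>v x) ` carrier_vec r) = card (carrier_vec r :: 'a vec set)"
    by (simp add: card_col_space[OF L] card_carrier_vec)
  then show ?thesis by (rule eq_card_imp_inj_on[OF finite_carrier_vec])
qed

text \<open>The columns of \<open>L\<close> form a basis of the column space of \<open>A\<close>,
  and those of \<open>M\<close> hold the coefficients of the columns of \<open>A\<close> in
  it.\<close>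

lemma rank_factorization:
  fixes A :: "'a::{field,finite} mat"
  assumes A: "A \<in> carrier_mat k n" and r: "vec_space.rank k A = r"
  obtains L M where "L \<in> carrier_mat k r" "M \<in> carrier_mat r n" "A = L * M"
proof -
  interpret vec_space "TYPE('a)" k .
  have cA: "set (cols A) \<subseteq> carrier_vec k" using cols_dim[of A] A by auto
  then have sub: "span (set (cols A)) \<in> subspaces k" by (rule span_subspace)
  obtain \<beta> where \<beta>: "finite \<beta>" "\<beta> \<subseteq> span (set (cols A))" "card \<beta> = r"
    "span \<beta> = span (set (cols A))"
    using subspace_basis[OF sub] r by (metis rank_def sdim_def)
  obtain bs where bs: "set bs = \<beta>" "distinct bs" using finite_distinct_list[OF \<beta>(1)] by blast
  have len: "length bs = r" using bs \<beta>(3) distinct_card by fastforce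
  have bc: "set bs \<subseteq> carrier_vec k" using bs(1) \<beta>(2) subspaces_subset[OF sub] by blast
  define L where "L = mat_of_cols k bs"
  have L: "L \<in> carrier_mat k r" unfolding L_def len[symmetric] by (rule mat_of_cols_carrier)
  have "col_space L = span (set (cols A))"
    unfolding col_space_def L_def using bs(1) \<beta>(4) by (simp add: cols_mat_of_cols[OF bc])
  then have "col A j \<in> (\<lambda>x. L *\<^sub>v x) ` carrier_vec r" if "j < n" for j
    using that A in_own_span[of "set (cols A)"] cA unfolding col_space_image[OF L]
    by (auto simp: cols_def)
  then have "\<forall>j. \<exists>x. j < n \<longrightarrow> x \<in> carrier_vec r \<and> L *\<^sub>v x = col A j" by (metis imageE)
  then obtain f where f: "\<And>j. j < n \<Longrightarrow> f j \<in> carrier_vec r \<and> L *\<^sub>v f j = col A j" by metis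
  define M where "M = mat_of_cols r (map f [0..<n])"
  have M: "M \<in> carrier_mat r n"
    using mat_of_cols_carrier(1)[of r "map f [0..<n]"] by (simp add: M_def)
  have "A = L * M"
  proof (rule mat_col_eqI)
    fix j assume "j < dim_col (L * M)"
    then have j: "j < n" using M by simp
    have "col M j = f j" using f j by (simp add: M_def)
    then show "col A j = col (L * M) j" using col_mult2[OF L M j] f[OF j] by simp
  qed (use A L M in auto)
  with L M show ?thesis using that by blast
qed

section \<open>The rank function of a matrix\<close>

lemma mat_rho_mult_inj:
  fixes \<iota> :: "'a::{field,finite} \<Rightarrow> 'b::{field,finite}"
  assumes \<iota>: "field_hom \<iota>" and L: "L \<in> carrier_mat k r" and G: "G \<in> carrier_mat r n"
    and inj: "inj_on (\<lambda>x. L *\<^sub>v x) (carrier_vec r)" and V: "V \<in> subspaces n"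
  shows "mat_rho \<iota> (L * G) V = mat_rho \<iota> G V"
proof -
  obtain Y where Y: "dim_col Y = n" "vec_space.row_space n Y = V" using ex_row_space[OF V] by blast
  let ?Y = "(map_mat \<iota> Y)\<^sup>T"
  have Yc: "?Y \<in> carrier_mat n (dim_row Y)" using Y by (intro carrier_matI) auto
  have "mat_rho \<iota> (L * G) V = vec_space.rank k (L * G * ?Y)"
    using mat_rho_eq[OF \<iota>, of Y "L * G" V] L G Y by simp
  also have "\<dots> = vec_space.rank k (L * (G * ?Y))" using assoc_mult_mat[OF L G Yc] by simp
  also have "\<dots> = vec_space.rank r (G * ?Y)" by (rule rank_mult_inj[OF L mult_carrier_mat[OF G Yc] inj])
  also have "\<dots> = mat_rho \<iota> G V" using mat_rho_eq[OF \<iota>, of Y G V] G Y by simp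
  finally show ?thesis .
qed

text \<open>A description free of the chosen \<open>Y\<close>. It allows comparing matrices with
  different numbers of columns: equal sets of image vectors give equal ranks.\<close>

lemma mat_rho_sdim_span:
  fixes \<iota> :: "'a::{field,finite} \<Rightarrow> 'b::{field,finite}"
  assumes \<iota>: "field_hom \<iota>" and G: "G \<in> carrier_mat k n" and V: "V \<in> subspaces n"
  shows "mat_rho \<iota> G V = sdim k (LinearCombinations.module.span class_ring (module_vec TYPE('b) k)
    ((\<lambda>v. G *\<^sub>v map_vec \<iota> v) ` V))"
proof -
  interpret A: vec_space "TYPE('a)" n .
  interpret B: vec_space "TYPE('b)" k .
  obtain vs where vs: "set vs = V" using finite_list[OF finite_subspace[OF V]] by blast
  have vc: "set vs \<subseteq> carrier_vec n" using vs subspaces_subset[OF V] by simp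
  \<comment> \<open>All vectors of \<open>V\<close> are taken as rows, not just a basis, so that the
    columns of the product are exactly the images of the vectors of \<open>V\<close>.\<close>
  define Y where "Y = mat_of_rows n vs"
  have sub: "submodule class_ring V A.V" using V by (simp add: subspaces_def VectorSpace.subspace_def)
  have "A.span V = V"
    using A.span_is_subset[OF _ sub] A.in_own_span[of V] subspaces_subset[OF V] by auto
  then have "A.row_space Y = V"
    unfolding A.row_space_def Y_def using vs rows_mat_of_rows[OF vc] by simp
  then have "mat_rho \<iota> G V = B.rank (G * (map_mat \<iota> Y)\<^sup>T)"
    using mat_rho_eq[OF \<iota>, of Y G V] G by (simp add: Y_def)
  moreover have "cols (G * (map_mat \<iota> Y)\<^sup>T) = map (\<lambda>v. G *\<^sub>v map_vec \<iota> v) vs"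
  proof (rule nth_equalityI)
    fix j assume "j < length (cols (G * (map_mat \<iota> Y)\<^sup>T))"
    then have j: "j < length vs" by (simp add: Y_def)
    have Yc: "(map_mat \<iota> Y)\<^sup>T \<in> carrier_mat n (length vs)" by (simp add: Y_def)
    have vsj: "vs ! j \<in> carrier_vec n" using nth_mem[OF j] vc by blast
    have jY: "j < dim_row (map_mat \<iota> Y)" using j by (simp add: Y_def)
    have "col (map_mat \<iota> Y)\<^sup>T j = map_vec \<iota> (vs ! j)"
      using j vsj unfolding col_transpose[OF jY] by (intro eq_vecI) (auto simp: Y_def mat_of_rows_def)
    then show "cols (G * (map_mat \<iota> Y)\<^sup>T) ! j = map (\<lambda>v. G *\<^sub>v map_vec \<iota> v) vs ! j"
      using j col_mult2[OF G Yc j] Yc by simp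
  qed (simp add: Y_def)
  ultimately show ?thesis by (simp add: B.rank_def sdim_def vs)
qed

lemma map_vec_append: "map_vec f (v @\<^sub>v w) = map_vec f v @\<^sub>v map_vec f w"
  by (intro eq_vecI) (auto simp: append_vec_def Let_def)

section \<open>The block diagonal representation\<close>

theorem theorem3p4:
  fixes \<iota> :: "'a::{field,finite} \<Rightarrow> 'b::{field,finite}"
    and \<rho>1 \<rho>2 :: "'a vec set \<Rightarrow> nat"
    and n1 n2 k1 k2 m :: nat
  assumes "CARD('b) = CARD('a) ^ m"
    and "field_hom \<iota>"
    and "q_matroid n1 \<rho>1" and "qm_rank n1 \<rho>1 = k1"
    and "q_matroid n2 \<rho>2" and "qm_rank n2 \<rho>2 = k2"
    and "representable \<iota> (n1 + n2) (qm_direct_sum n1 n2 \<rho>1 \<rho>2)"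
  shows "representable \<iota> n1 \<rho>1 \<and> representable \<iota> n2 \<rho>2 \<and>
    (\<exists>G1 G2. G1 \<in> carrier_mat k1 n1 \<and> G2 \<in> carrier_mat k2 n2 \<and>
       qm_eq n1 (mat_rho \<iota> G1) \<rho>1 \<and> qm_eq n2 (mat_rho \<iota> G2) \<rho>2 \<and>
       qm_eq (n1 + n2)
         (mat_rho \<iota> (four_block_mat G1 (0\<^sub>m k1 n2) (0\<^sub>m k2 n1) G2))
         (qm_direct_sum n1 n2 \<rho>1 \<rho>2))"
proof -
  note \<iota> = assms(2) and q1 = assms(3) and q2 = assms(5)
  interpret \<iota>: field_hom \<iota> by fact
  let ?\<rho> = "qm_direct_sum n1 n2 \<rho>1 \<rho>2"
  obtain G :: "'b mat" where Gd: "dim_col G = n1 + n2" and G\<rho>: "qm_eq (n1 + n2) (mat_rho \<iota> G) ?\<rho>"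
    using assms(7) unfolding representable_def by blast
  define k where "k = dim_row G"
  have G: "G \<in> carrier_mat k (n1 + n2)" using Gd unfolding k_def by (intro carrier_matI) auto
  define A where "A = mat k n1 (\<lambda>(i, j). G $$ (i, j))"
  define B where "B = mat k n2 (\<lambda>(i, j). G $$ (i, n1 + j))"
  have A: "A \<in> carrier_mat k n1" and B: "B \<in> carrier_mat k n2" by (simp_all add: A_def B_def)
  \<comment> \<open>Lower blocks of height 0 express \<open>(A | B)\<close> as a block matrix, which
    makes the block multiplication rules applicable; \<open>L\<close> is built the same way
    below.\<close>
  have GAB: "G = four_block_mat A B (0\<^sub>m 0 n1) (0\<^sub>m 0 n2)"
    using G by (intro eq_matI) (auto simp: A_def B_def)
  have Gv: "G *\<^sub>v (v @\<^sub>v w) = A *\<^sub>v v + B *\<^sub>v w" if "v \<in> carrier_vec n1" "w \<in> carrier_vec n2" for v w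
    unfolding GAB four_block_mat_mult_vec[OF A B zero_carrier_mat zero_carrier_mat that]
    using A B that by (intro eq_vecI) auto
  have Grho: "mat_rho \<iota> G (vec_prod V1 V2) = \<rho>1 V1 + \<rho>2 V2"
    if "V1 \<in> subspaces n1" "V2 \<in> subspaces n2" for V1 V2
    using G\<rho> vec_prod_subspace[OF that] qm_direct_sum_vec_prod[OF q1 q2 that]
    by (simp add: qm_eq_def)
  have z: "map_vec \<iota> (0\<^sub>v n) = 0\<^sub>v n" for n by (intro eq_vecI) auto
  \<comment> \<open>Padding by zeros switches off the block \<open>B\<close>, so \<open>A\<close> on
    \<open>V\<close> and \<open>G\<close> on the padded copy of \<open>V\<close> yield the same set
    of image vectors.\<close>
  have A\<rho>: "mat_rho \<iota> A V = \<rho>1 V" if V: "V \<in> subspaces n1" for V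
  proof -
    have "G *\<^sub>v map_vec \<iota> (v @\<^sub>v 0\<^sub>v n2) = A *\<^sub>v map_vec \<iota> v" if "v \<in> V" for v
    proof -
      have "map_vec \<iota> v \<in> carrier_vec n1" using that subspaces_subset[OF V] by auto
      then show ?thesis unfolding map_vec_append z
        using A B by (subst Gv) (auto intro!: eq_vecI)
    qed
    moreover have prod: "vec_prod V {0\<^sub>v n2} = (\<lambda>v. v @\<^sub>v 0\<^sub>v n2) ` V"
      unfolding vec_prod_def by auto
    ultimately have "(\<lambda>v. G *\<^sub>v map_vec \<iota> v) ` vec_prod V {0\<^sub>v n2} = (\<lambda>v. A *\<^sub>v map_vec \<iota> v) ` V"
      unfolding prod image_image by (intro image_cong) auto
    then have "mat_rho \<iota> A V = mat_rho \<iota> G (vec_prod V {0\<^sub>v n2})"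
      using mat_rho_sdim_span[OF \<iota> G vec_prod_subspace[OF V zero_subspace]]
        mat_rho_sdim_span[OF \<iota> A V] by simp
    then show ?thesis using Grho[OF V zero_subspace] q_matroid_zero[OF q2] by simp
  qed
  have B\<rho>: "mat_rho \<iota> B V = \<rho>2 V" if V: "V \<in> subspaces n2" for V
  proof -
    have "G *\<^sub>v map_vec \<iota> (0\<^sub>v n1 @\<^sub>v v) = B *\<^sub>v map_vec \<iota> v" if "v \<in> V" for v
    proof -
      have "map_vec \<iota> v \<in> carrier_vec n2" using that subspaces_subset[OF V] by auto
      then show ?thesis unfolding map_vec_append z
        using A B by (subst Gv) (auto intro!: eq_vecI)
    qed
    moreover have prod: "vec_prod {0\<^sub>v n1} V = (\<lambda>v. 0\<^sub>v n1 @\<^sub>v v) ` V"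
      unfolding vec_prod_def by auto
    ultimately have "(\<lambda>v. G *\<^sub>v map_vec \<iota> v) ` vec_prod {0\<^sub>v n1} V = (\<lambda>v. B *\<^sub>v map_vec \<iota> v) ` V"
      unfolding prod image_image by (intro image_cong) auto
    then have "mat_rho \<iota> B V = mat_rho \<iota> G (vec_prod {0\<^sub>v n1} V)"
      using mat_rho_sdim_span[OF \<iota> G vec_prod_subspace[OF zero_subspace V]]
        mat_rho_sdim_span[OF \<iota> B V] by simp
    then show ?thesis using Grho[OF zero_subspace V] q_matroid_zero[OF q1] by simp
  qed
  have rA: "vec_space.rank k A = k1"
    using qm_rank_mat_rho[OF \<iota>, of A n1] A A\<rho>[OF carrier_subspace] assms(4)
    by (simp add: qm_rank_def)
  have rB: "vec_space.rank k B = k2"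
    using qm_rank_mat_rho[OF \<iota>, of B n2] B B\<rho>[OF carrier_subspace] assms(6)
    by (simp add: qm_rank_def)
  \<comment> \<open>The whole space is itself a product, so \<open>Grho\<close> gives the rank of
    \<open>G\<close>.\<close>
  have "carrier_vec (n1 + n2) = vec_prod (carrier_vec n1) (carrier_vec n2 :: 'a vec set)"
    (is "_ = ?P")
  proof (rule antisym)
    show "?P \<subseteq> carrier_vec (n1 + n2)"
      by (rule subspaces_subset[OF vec_prod_subspace[OF carrier_subspace carrier_subspace]])
    show "carrier_vec (n1 + n2) \<subseteq> ?P"
    proof
      fix x :: "'a vec" assume "x \<in> carrier_vec (n1 + n2)"
      then show "x \<in> ?P" unfolding vec_prod_def
        by (intro image_eqI[of _ _ "(vec_first x n1, vec_last x n2)"]) auto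
    qed
  qed
  then have rG: "vec_space.rank k G = k1 + k2"
    using qm_rank_mat_rho[OF \<iota> Gd] Grho[OF carrier_subspace carrier_subspace] assms(4,6)
    by (simp add: qm_rank_def k_def)
  obtain L1 G1 where L1: "L1 \<in> carrier_mat k k1" and G1: "G1 \<in> carrier_mat k1 n1" and AL: "A = L1 * G1"
    using rank_factorization[OF A rA] .
  obtain L2 G2 where L2: "L2 \<in> carrier_mat k k2" and G2: "G2 \<in> carrier_mat k2 n2" and BL: "B = L2 * G2"
    using rank_factorization[OF B rB] .
  define L where "L = four_block_mat L1 L2 (0\<^sub>m 0 k1) (0\<^sub>m 0 k2)"
  define D where "D = four_block_mat G1 (0\<^sub>m k1 n2) (0\<^sub>m k2 n1) G2"
  have L: "L \<in> carrier_mat k (k1 + k2)"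
    unfolding L_def using four_block_carrier_mat[OF L1 zero_carrier_mat[of 0 k2]] by simp
  have D: "D \<in> carrier_mat (k1 + k2) (n1 + n2)"
    unfolding D_def by (rule four_block_carrier_mat[OF G1 G2])
  have GLD: "G = L * D"
    unfolding GAB L_def D_def AL BL
    using mult_four_block_mat[OF L1 L2 zero_carrier_mat[of 0 k1] zero_carrier_mat[of 0 k2]
        G1 zero_carrier_mat[of k1 n2] zero_carrier_mat[of k2 n1] G2] L1 L2 G1 G2
    by simp
  \<comment> \<open>By \<open>rA\<close> the product \<open>L1 * G1\<close> has rank equal to the
    number of columns of \<open>L1\<close>, so \<open>L1\<close> can be cancelled from
    \<open>A\<close>.\<close>
  have "qm_eq n1 (mat_rho \<iota> G1) \<rho>1"
    using mat_rho_mult_inj[OF \<iota> L1 G1 inj_on_left_factor[OF L1 G1]] rA A\<rho>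
    by (simp add: qm_eq_def AL)
  moreover have "qm_eq n2 (mat_rho \<iota> G2) \<rho>2"
    using mat_rho_mult_inj[OF \<iota> L2 G2 inj_on_left_factor[OF L2 G2]] rB B\<rho>
    by (simp add: qm_eq_def BL)
  \<comment> \<open>Additivity of the ranks enters here: \<open>rG\<close> equals the number of
    columns of \<open>L\<close>, so the columns of \<open>L1\<close> and \<open>L2\<close> are
    jointly independent.\<close>
  moreover have "qm_eq (n1 + n2) (mat_rho \<iota> D) ?\<rho>"
    using mat_rho_mult_inj[OF \<iota> L D inj_on_left_factor[OF L D]] rG G\<rho>
    by (simp add: qm_eq_def GLD)
  ultimately show ?thesis
    using G1 G2 unfolding representable_def D_def by (metis carrier_matD(2))
qed

end
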